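(* Let $\mathcal{H}$ be a complex Hilbert space, let $A\in\mathbb{B}(\mathcal{H})$ be a positive contractive operator and let $x,y\in\mathcal{H}$. Then \[ 0\le \sqrt{\langle(A-A^2)x,x\rangle\,\langle(A-A^2)y,y\rangle}-\big|\langle(A-A^2)x,y\rangle\big|\le \frac{\|x\|\,\|y\|-|\langle x,y\rangle|}{4}. \]
   Context: $\mathbb{B}(\mathcal{H})$ is the algebra of all bounded linear operators on $\mathcal{H}$. An operator $A\in\mathbb{B}(\mathcal{H})$ is positive ($A\ge0$) if $\langle Ax,x\rangle\ge0$ for all $x\in\mathcal{H}$; for self-adjoint $A,B$, $A\le B$ means $B-A\ge0$. $A$ is positive contractive if $0\le A\le I$, where $I$ is the identity operator. *)

theory Defs
  imports "HOL-Analysis.Analysis" "HOL-Library.Complex_Order"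
begin

class complex_vector = real_vector +
  fixes scaleC :: "complex \<Rightarrow> 'a \<Rightarrow> 'a" (infixr "*\<^sub>C" 75)
  assumes scaleC_add_right: "a *\<^sub>C (x + y) = a *\<^sub>C x + a *\<^sub>C y"
    and scaleC_add_left: "(a + b) *\<^sub>C x = a *\<^sub>C x + b *\<^sub>C x"
    and scaleC_scaleC: "a *\<^sub>C b *\<^sub>C x = (a * b) *\<^sub>C x"
    and scaleC_one: "1 *\<^sub>C x = x"
    and scaleR_scaleC: "r *\<^sub>R x = complex_of_real r *\<^sub>C x"

text \<open>The inner product is linear in its first and conjugate-linear in its second argument.
  The order in \<open>0 \<le> cinner x x\<close> is the one from \<^theory>\<open>HOL-Library.Complex_Order\<close>, for which
  \<open>0 \<le> z\<close> means that \<open>z\<close> is real and nonnegative.\<close>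

class complex_inner = complex_vector + real_normed_vector +
  fixes cinner :: "'a \<Rightarrow> 'a \<Rightarrow> complex"
  assumes cinner_commute: "cinner x y = cnj (cinner y x)"
    and cinner_add_left: "cinner (x + y) z = cinner x z + cinner y z"
    and cinner_scaleC_left: "cinner (a *\<^sub>C x) y = a * cinner x y"
    and cinner_ge_zero: "0 \<le> cinner x x"
    and cinner_eq_zero_iff: "cinner x x = 0 \<longleftrightarrow> x = 0"
    and norm_eq_sqrt_cinner: "norm x = sqrt (cmod (cinner x x))"

class chilbert_space = complex_inner + complete_space

definition bounded_clinear :: "('a::complex_inner \<Rightarrow> 'b::complex_inner) \<Rightarrow> bool" where
  "bounded_clinear A \<longleftrightarrow>
     (\<forall>x y. A (x + y) = A x + A y) \<and>
     (\<forall>c x. A (c *\<^sub>C x) = c *\<^sub>C A x) \<and>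
     (\<exists>K. \<forall>x. norm (A x) \<le> K * norm x)"

definition positive_op :: "('a::complex_inner \<Rightarrow> 'a) \<Rightarrow> bool" where
  "positive_op A \<longleftrightarrow> (\<forall>x. 0 \<le> cinner (A x) x)"

definition op_le :: "('a::complex_inner \<Rightarrow> 'a) \<Rightarrow> ('a \<Rightarrow> 'a) \<Rightarrow> bool" where
  "op_le A B \<longleftrightarrow> positive_op (B - A)"

definition positive_contractive :: "('a::complex_inner \<Rightarrow> 'a) \<Rightarrow> bool" where
  "positive_contractive A \<longleftrightarrow> op_le (\<lambda>_. 0) A \<and> op_le A id"

instantiation complex :: chilbert_space
begin

definition scaleC_complex :: "complex \<Rightarrow> complex \<Rightarrow> complex" where
  "scaleC_complex a x = a * x"

definition cinner_complex :: "complex \<Rightarrow> complex \<Rightarrow> complex" where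
  "cinner_complex x y = x * cnj y"

instance
proof
  fix x y z a b :: complex and r :: real
  show "0 \<le> cinner x x"
    by (simp add: cinner_complex_def less_eq_complex_def)
  show "norm x = sqrt (cmod (cinner x x))"
    by (simp add: cinner_complex_def norm_mult)
qed (simp_all add: scaleC_complex_def cinner_complex_def algebra_simps scaleR_conv_of_real)

end

text \<open>Positivity forces an operator on a complex space to be symmetric, so that
  \<open>cinner ((A - A ^^ 2) x) x\<close> is a real number and may be represented by its real part.\<close>

lemma cinner_add_right: "cinner x (y + z) = cinner x y + cinner x (z :: 'a::complex_inner)"
  by (metis cinner_add_left cinner_commute complex_cnj_add)

lemma cinner_scaleC_right: "cinner x (a *\<^sub>C y) = cnj a * cinner x (y :: 'a::complex_inner)"
  by (metis cinner_commute cinner_scaleC_left complex_cnj_mult)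

lemma cinner_diff_left: "cinner (x - y) z = cinner x z - cinner y (z :: 'a::complex_inner)"
  by (metis add_diff_cancel_right' cinner_add_left diff_add_cancel)

lemma positive_op_symmetric:
  fixes A :: "'a::complex_inner \<Rightarrow> 'a"
  assumes "bounded_clinear A" and "positive_op A"
  shows "cinner (A x) y = cinner x (A y)"
proof -
  have add: "A (u + v) = A u + A v" and scale: "A (c *\<^sub>C u) = c *\<^sub>C A u" for u v c
    using assms(1) by (auto simp: bounded_clinear_def)
  have im: "Im (cinner (A u) u) = 0" for u
    using assms(2) by (simp add: positive_op_def less_eq_complex_def)
  have "Im (cinner (A x) y + cinner (A y) x) = 0"
    using im[of "x + y"] im[of x] im[of y] by (simp add: add cinner_add_left cinner_add_right)
  moreover have "Re (cinner (A x) y) = Re (cinner (A y) x)"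
    using im[of "x + \<i> *\<^sub>C y"] im[of x] im[of y]
    by (simp add: add scale cinner_add_left cinner_add_right cinner_scaleC_left cinner_scaleC_right)
  ultimately have "cinner (A x) y = cnj (cinner (A y) x)"
    by (simp add: complex_eq_iff)
  then show ?thesis
    by (metis cinner_commute)
qed

lemma cinner_diff_square_real:
  fixes A :: "'a::complex_inner \<Rightarrow> 'a"
  assumes "bounded_clinear A" and "positive_contractive A"
  shows "cinner ((A - A ^^ 2) x) x \<in> \<real>"
proof -
  have pos: "positive_op A"
    using assms(2) by (simp add: positive_contractive_def op_le_def positive_op_def)
  have "cinner ((A - A ^^ 2) x) x = cinner (A x) x - cinner (A x) (A x)"
    using positive_op_symmetric[OF assms(1) pos, of "A x" x]
    by (simp add: cinner_diff_left numeral_2_eq_2)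
  moreover have "0 \<le> cinner (A x) x" "0 \<le> cinner (A x) (A x)"
    using pos cinner_ge_zero by (auto simp: positive_op_def)
  ultimately show ?thesis
    by (simp add: complex_is_Real_iff less_eq_complex_def)
qed

end

theory Submission
  imports Defs
begin

text \<open>The \<^emph>\<open>Cauchy--Schwarz defect\<close> \<open>sqrt (q x x * q y y) - \<bar>q x y\<bar>\<close> of a positive
  semidefinite form \<open>q\<close> is superadditive in \<open>q\<close>, because the product term is superadditive and
  \<open>\<bar>q x y\<bar>\<close> is subadditive. Since the defect is also nonnegative, it can only grow when a
  positive form is added (\<open>cauchy_schwarz_defect_mono\<close>).

  The form of \<open>A - A\<^sup>2\<close> is positive by the factorisation
  \<open>A - A\<^sup>2 = A (I - A) A + (I - A) A (I - A)\<close> (\<open>positive_form_diff_square\<close>). Adding to it the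
  positive form of \<open>(A - I/2)\<^sup>2\<close> completes the square: the result is the form of \<open>I/4\<close>, whose
  defect is the right-hand side of the claim.\<close>

text \<open>The comparison involves the forms of three different operators, so the Cauchy--Schwarz
  argument is set up for forms instead of operators.\<close>

definition positive_form :: "('a::complex_vector \<Rightarrow> 'a \<Rightarrow> complex) \<Rightarrow> bool" where
  "positive_form q \<longleftrightarrow>
     (\<forall>x y z. q (x + y) z = q x z + q y z) \<and>
     (\<forall>c x y. q (c *\<^sub>C x) y = c * q x y) \<and>
     (\<forall>x y. q x y = cnj (q y x)) \<and>
     (\<forall>x. 0 \<le> q x x)"

lemma positive_form_diagonal:
  assumes "positive_form q"
  shows positive_form_nonneg: "0 \<le> Re (q x x)" and positive_form_real: "Im (q x x) = 0"
proof -
  have "0 \<le> q x x"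
    using assms unfolding positive_form_def by blast
  then show "0 \<le> Re (q x x)" and "Im (q x x) = 0"
    by (simp_all add: less_eq_complex_def)
qed

lemma positive_form_shift:
  assumes "positive_form q"
  shows "Re (q (x + c *\<^sub>C y) (x + c *\<^sub>C y))
    = Re (q x x) + 2 * Re (cnj c * q x y) + (cmod c)\<^sup>2 * Re (q y y)"
proof -
  have add: "q (u + v) w = q u w + q v w" and scale: "q (d *\<^sub>C u) v = d * q u v"
    and herm: "q u v = cnj (q v u)" for u v w d
    using assms unfolding positive_form_def by blast+
  have add_right: "q w (u + v) = q w u + q w v" for u v w
    by (metis add herm complex_cnj_add)
  have scale_right: "q u (d *\<^sub>C v) = cnj d * q u v" for u v d
    by (metis scale herm complex_cnj_mult)
  have yx: "q y x = cnj (q x y)"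
    by (rule herm)
  show ?thesis
    unfolding cmod_power2
    by (simp add: add add_right scale scale_right positive_form_real[OF assms] yx
        algebra_simps power2_eq_square)
qed

text \<open>The form may be degenerate, so the usual division by \<open>q y y\<close> has to be complemented by an
  argument for \<open>q y y = 0\<close>: there \<open>q (x + c y) (x + c y)\<close> is real-affine in \<open>c\<close>,
  hence bounded below only if \<open>q x y = 0\<close>.\<close>

lemma positive_form_cauchy_schwarz:
  assumes "positive_form q"
  shows "cmod (q x y) \<le> sqrt (Re (q x x) * Re (q y y))"
proof -
  define a where "a = (cmod (q x y))\<^sup>2"
  define b where "b = Re (q y y)"
  have quad: "0 \<le> Re (q x x) - 2 * r * a + r\<^sup>2 * a * b" for r :: real
  proof -
    \<comment> \<open>With this phase of \<open>c\<close> the cross term is as negative as its modulus permits for \<open>r > 0\<close>.\<close>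
    define c where "c = - complex_of_real r * q x y"
    have cross: "Re (cnj c * q x y) = - r * a"
      unfolding c_def a_def cmod_power2 by (simp add: power2_eq_square distrib_left)
    have len: "(cmod c)\<^sup>2 = r\<^sup>2 * a"
      by (simp add: c_def a_def norm_mult power_mult_distrib)
    have "0 \<le> Re (q x x) + 2 * (- r * a) + r\<^sup>2 * a * b"
      using positive_form_nonneg[OF assms, of "x + c *\<^sub>C y"]
      unfolding positive_form_shift[OF assms] cross len b_def .
    then show ?thesis
      by simp
  qed
  have "a \<le> Re (q x x) * b"
  proof (cases "b = 0")
    case True
    have "a = 0"
    proof (rule ccontr)
      assume "a \<noteq> 0"
      \<comment> \<open>For this \<open>r\<close> the affine function takes the value \<open>- 1\<close>.\<close>
      define r where "r = (Re (q x x) + 1) / (2 * a)"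
      have "2 * r * a = Re (q x x) + 1"
        using \<open>a \<noteq> 0\<close> by (simp add: r_def)
      moreover have "r\<^sup>2 * a * b = 0"
        by (simp add: True)
      ultimately show False
        using quad[of r] by linarith
    qed
    then show ?thesis using True by simp
  next
    case False
    have "0 \<le> b"
      unfolding b_def by (rule positive_form_nonneg[OF assms])
    with False have "0 < b"
      by linarith
    have "(1 / b)\<^sup>2 * a * b = a / b"
      using False by (simp add: power2_eq_square)
    moreover have "2 * (1 / b) * a = 2 * (a / b)"
      by simp
    ultimately have "a / b \<le> Re (q x x)"
      using quad[of "1 / b"] by linarith
    with \<open>0 < b\<close> show ?thesis
      by (simp add: pos_divide_le_eq)
  qed
  then show ?thesis
    unfolding a_def b_def by (rule real_le_rsqrt)
qed

text \<open>This is the Cauchy--Schwarz inequality in the plane for the vectors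
  \<open>(sqrt a, sqrt c)\<close> and \<open>(sqrt b, sqrt d)\<close>.\<close>

lemma sqrt_mult_superadditive:
  fixes a b c d :: real
  assumes "0 \<le> a" "0 \<le> b" "0 \<le> c" "0 \<le> d"
  shows "sqrt (a * b) + sqrt (c * d) \<le> sqrt ((a + c) * (b + d))"
proof (rule real_le_rsqrt)
  have "2 * (sqrt (a * d) * sqrt (c * b)) \<le> a * d + c * b"
    using assms sum_squares_bound[of "sqrt (a * d)" "sqrt (c * b)"] by simp
  moreover have "sqrt (a * d) * sqrt (c * b) = sqrt (a * b) * sqrt (c * d)"
    by (simp add: real_sqrt_mult mult_ac)
  ultimately show "(sqrt (a * b) + sqrt (c * d))\<^sup>2 \<le> (a + c) * (b + d)"
    using assms by (simp add: power2_sum algebra_simps)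
qed

text \<open>The defect of \<open>p + q\<close> dominates the sum of the two defects, and the defect of \<open>q\<close> is
  dropped because it is nonnegative.\<close>

lemma cauchy_schwarz_defect_mono:
  assumes "positive_form p" "positive_form q"
  shows "sqrt (Re (p x x) * Re (p y y)) - cmod (p x y)
    \<le> sqrt (Re (p x x + q x x) * Re (p y y + q y y)) - cmod (p x y + q x y)"
proof -
  have "sqrt (Re (p x x) * Re (p y y)) + sqrt (Re (q x x) * Re (q y y))
      \<le> sqrt (Re (p x x + q x x) * Re (p y y + q y y))"
    using sqrt_mult_superadditive[of "Re (p x x)" "Re (p y y)" "Re (q x x)" "Re (q y y)"]
    by (simp add: positive_form_nonneg assms)
  moreover have "cmod (q x y) \<le> sqrt (Re (q x x) * Re (q y y))"
    by (rule positive_form_cauchy_schwarz[OF assms(2)])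
  ultimately show ?thesis
    using norm_triangle_ineq[of "p x y" "q x y"] by linarith
qed

lemma cinner_diff_right: "cinner z (x - y) = cinner z x - cinner z (y :: 'a::complex_inner)"
  by (metis cinner_commute cinner_diff_left complex_cnj_diff)

lemma positive_form_cinner_image:
  fixes T :: "'a::complex_vector \<Rightarrow> 'b::complex_inner"
  assumes "\<And>x y. T (x + y) = T x + T y" and "\<And>c x. T (c *\<^sub>C x) = c *\<^sub>C T x"
  shows "positive_form (\<lambda>x y. cinner (T x) (T y))"
  unfolding positive_form_def
  by (intro conjI allI cinner_commute cinner_ge_zero)
    (simp_all add: assms cinner_add_left cinner_scaleC_left)

lemma scaleC_diff_right: "c *\<^sub>C (x - y) = c *\<^sub>C x - c *\<^sub>C (y :: 'a::complex_vector)"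
  by (metis add_diff_cancel_right' scaleC_add_right diff_add_cancel)

text \<open>In \<open>A (I - A) A\<close> and \<open>(I - A) A (I - A)\<close> the leftmost factor moves to the second
  argument of the inner product by symmetry, so the factorisation of \<open>A - A\<^sup>2\<close> reduces
  positivity to \<open>I - A \<ge> 0\<close> at \<open>A x\<close> and \<open>A \<ge> 0\<close> at \<open>x - A x\<close>.\<close>

lemma positive_form_diff_square:
  fixes A :: "'a::complex_inner \<Rightarrow> 'a"
  assumes "bounded_clinear A" and "positive_contractive A"
  shows "positive_form (\<lambda>x y. cinner ((A - A ^^ 2) x) y)"
proof -
  have pos: "positive_op A" and pos': "positive_op (id - A)"
    using assms(2) by (simp_all add: positive_contractive_def op_le_def positive_op_def)
  have add: "A (u + v) = A u + A v" and scale: "A (c *\<^sub>C u) = c *\<^sub>C A u" for u v c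
    using assms(1) by (auto simp: bounded_clinear_def)
  have diff: "A (u - v) = A u - A v" for u v
    by (metis add add_diff_cancel_right' diff_add_cancel)
  have sym: "cinner (A u) v = cinner u (A v)" for u v
    by (rule positive_op_symmetric[OF assms(1) pos])
  have sq: "(A - A ^^ 2) u = A u - A (A u)" for u
    by (simp add: numeral_2_eq_2)
  have "cinner ((A - A ^^ 2) x) x
      = cinner ((id - A) (A x)) (A x) + cinner (A (x - A x)) (x - A x)" for x
    unfolding sq by (simp add: diff cinner_diff_left cinner_diff_right sym)
  then have nonneg: "0 \<le> cinner ((A - A ^^ 2) x) x" for x
    using pos pos' by (simp add: positive_op_def)
  have herm: "cinner ((A - A ^^ 2) x) y = cnj (cinner ((A - A ^^ 2) y) x)" for x y
    unfolding sq cinner_diff_left sym cinner_diff_right complex_cnj_diff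
    by (subst (1 2) cinner_commute) (simp add: sym)
  show ?thesis
    unfolding positive_form_def
    by (intro conjI allI nonneg herm; unfold sq)
      (simp_all add: add scale cinner_add_left cinner_diff_left cinner_scaleC_left right_diff_distrib)
qed

theorem theorem3p1:
  fixes A :: "'a::chilbert_space \<Rightarrow> 'a" and x y :: 'a
  assumes "bounded_clinear A"
    and "positive_contractive A"
  shows "0 \<le> sqrt (Re (cinner ((A - A ^^ 2) x) x) * Re (cinner ((A - A ^^ 2) y) y))
              - cmod (cinner ((A - A ^^ 2) x) y)
       \<and> sqrt (Re (cinner ((A - A ^^ 2) x) x) * Re (cinner ((A - A ^^ 2) y) y))
              - cmod (cinner ((A - A ^^ 2) x) y)
           \<le> (norm x * norm y - cmod (cinner x y)) / 4"
proof
  let ?p = "\<lambda>u v. cinner ((A - A ^^ 2) u) v"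
  define T where "T u = A u - (1/2) *\<^sub>C u" for u
  let ?q = "\<lambda>u v. cinner (T u) (T v)"
  have p: "positive_form ?p"
    by (rule positive_form_diff_square[OF assms])
  have pos: "positive_op A"
    using assms(2) by (simp add: positive_contractive_def op_le_def positive_op_def)
  have add: "A (u + v) = A u + A v" and scale: "A (c *\<^sub>C u) = c *\<^sub>C A u" for u v c
    using assms(1) by (auto simp: bounded_clinear_def)
  have q: "positive_form ?q"
    by (rule positive_form_cinner_image)
      (simp_all add: T_def add scale scaleC_add_right scaleC_diff_right scaleC_scaleC mult.commute)
  have sum: "?p u v + ?q u v = cinner u v / 4" for u v
    by (simp add: T_def numeral_2_eq_2 cinner_diff_left cinner_diff_right cinner_scaleC_left
        cinner_scaleC_right positive_op_symmetric[OF assms(1) pos])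
      (simp add: diff_divide_distrib)
  have norm: "Re (cinner u u / 4) = (norm u)\<^sup>2 / 4" for u :: 'a
    using cinner_ge_zero[of u]
    by (simp add: norm_eq_sqrt_cinner[of u] less_eq_complex_def cmod_eq_Re)
  show "0 \<le> sqrt (Re (?p x x) * Re (?p y y)) - cmod (?p x y)"
    using positive_form_cauchy_schwarz[OF p, of x y] by simp
  have "sqrt (Re (?p x x) * Re (?p y y)) - cmod (?p x y)
      \<le> sqrt (Re (cinner x x / 4) * Re (cinner y y / 4)) - cmod (cinner x y / 4)"
    using cauchy_schwarz_defect_mono[OF p q, of x y] unfolding sum .
  also have "sqrt (Re (cinner x x / 4) * Re (cinner y y / 4)) = norm x * norm y / 4"
    unfolding norm by (rule real_sqrt_unique) (simp_all add: power_mult_distrib power_divide)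
  also have "norm x * norm y / 4 - cmod (cinner x y / 4) = (norm x * norm y - cmod (cinner x y)) / 4"
    by (simp add: norm_divide diff_divide_distrib)
  finally show "sqrt (Re (?p x x) * Re (?p y y)) - cmod (?p x y)
      \<le> (norm x * norm y - cmod (cinner x y)) / 4" .
qed

end
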